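(* Let $d\geqslant 2$, $\beta\geqslant 1$, $p\geqslant1$ and $n\geqslant1$ be integers, let $1\leqslant\gamma_1\leqslant\cdots\leqslant\gamma_{d-1}\leqslant\beta$ be integers, and let $\Gamma=\{p,\gamma_1n+p,\ldots,\gamma_{d-1}n+p\}$. For $k=1,\ldots,\beta-1$ put $\mu_k=d-1-\sum_{m=1}^{d-1}e^{2\pi i\gamma_mk/\beta}$ and $\eta_k=2(d-1)-2\sum_{m=1}^{d-1}\cos(2\pi\gamma_mk/\beta)$. Then the number of spanning trees $\tau(\overrightarrow{C}^{\Gamma}_{\beta n})$ of the directed circulant graph $\overrightarrow{C}^{\Gamma}_{\beta n}$ satisfies the following. (i) If $n$ is even and $(p,n)=1$, then \begin{align*} \tau(\overrightarrow{C}^{\Gamma}_{\beta n})&=nd^{\beta n-1}\Big(1-\delta_{\beta\text{ even}}\frac{(-1)^p}{d^n}\Big(1+\sum_{m=1}^{d-1}(-1)^{\gamma_m}\Big)^n\Big)\\ &\times\prod_{k=1}^{\lceil\beta/2\rceil-1}\left(1-2\Big|1-\frac{\mu_k}{d}\Big|^n\cos\left(\frac{2\pi pk}{\beta}+n\arctan\left(\frac{\sum_{m=1}^{d-1}\sin(2\pi\gamma_mk/\beta)}{d-\eta_k/2}\right)\right)+\Big|1-\frac{\mu_k}{d}\Big|^{2n}\right). \end{align*} (ii) If $n$ is odd and $(p,n)=1$, then \begin{align*} &\tau(\overrightarrow{C}^{\Gamma}_{\beta n})=nd^{\beta n-1}\Big(1-\delta_{\beta\text{ even}}\frac{(-1)^p}{d^n}\Big(1+\sum_{m=1}^{d-1}(-1)^{\gamma_m}\Big)^n\Big)\\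 &\times\prod_{k=1}^{\lceil\beta/2\rceil-1}\left(1-2\,\mathrm{sgn}(d-\eta_k/2)\Big|1-\frac{\mu_k}{d}\Big|^n\cos\left(\frac{2\pi pk}{\beta}+n\arctan\left(\frac{\sum_{m=1}^{d-1}\sin(2\pi\gamma_mk/\beta)}{d-\eta_k/2}\right)\right)+\Big|1-\frac{\mu_k}{d}\Big|^{2n}\right). \end{align*} (iii) $\tau(\overrightarrow{C}^{\Gamma}_{\beta n})=0$ if either $(p,n)=1$ and $\beta$, $p$, $\gamma_1,\ldots,\gamma_{d-1}$ are all even, or $(p,n)\neq1$.
   Context: For positive integers $N$ and $g_1,\ldots,g_d$, the directed circulant graph $\overrightarrow{C}^{g_1,\ldots,g_d}_N$ is the directed graph with vertex set $\mathbb{Z}/N\mathbb{Z}$ having, for each vertex $v$ and each $m\in\{1,\ldots,d\}$, one oriented edge from $v$ to $v+g_m \bmod N$. Generators are listed with multiplicity: if some $g_m$ coincide modulo $N$ the corresponding parallel edges are counted as distinct, and the out-degree of each vertex is $d$. A spanning arborescence converging to a vertex $v$ of a directed graph $G$ is a connected spanning oriented subgraph (an oriented tree) in which every vertex other than $v$ has out-degree one and $v$ has out-degree zero; $\tau^-(G,v)$ is the number of these. Equivalently, by the Tutte matrix tree theorem, $\tau^-(G,v)$ is the determinant of the matrix obtained by deleting the row and column of $v$ from the Laplacian $\Delta_G^-=D^--A$, where $D^-$ is the diagonal matrix of out-degrees and $A_{ij}$ is the number of edges from $i$ to $j$. For a regular directed graph $G$, the number of spanning trees is defined as $\tau(G)=\sum_{v\in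 V(G)}\tau^-(G,v)$ (sum over all roots). Notation: $(p,n)$ is the greatest common divisor; $\lceil x\rceil$ is the smallest integer greater than or equal to $x$; $|\cdot|$ is the complex modulus; empty products equal $1$; $\delta_A=1$ if the statement $A$ holds and $0$ otherwise; $\mathrm{sgn}$ is the sign function with the convention $\mathrm{sgn}(0)=1$. When $d-\eta_k/2=0$, the arctangent is interpreted as its limit as $d-\eta_k/2\to0^+$, i.e. as $\pi/2$ or $-\pi/2$ according to whether $\sum_{m=1}^{d-1}\sin(2\pi\gamma_mk/\beta)$ is positive or negative (if this sum is also $0$ then $|1-\mu_k/d|=0$ and the value assigned is irrelevant). *)

theory Defs
  imports Complex_Main "Graph_Theory.Digraph_Component"
begin

text \<open>
  The residues modulo \<open>N\<close> are represented by \<open>{..<N}\<close>.  The arc \<open>(v, m)\<close> is the edge from \<open>v\<close>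
  belonging to the generator at position \<open>m\<close> of the list, so that generators that coincide
  modulo \<open>N\<close> give parallel arcs (and generators divisible by \<open>N\<close> give loops).
\<close>

definition circulant_digraph :: "nat \<Rightarrow> nat list \<Rightarrow> (nat, nat \<times> nat) pre_digraph" where
  "circulant_digraph N gs =
     \<lparr>verts = {..<N}, arcs = {..<N} \<times> {..<length gs},
      tail = (\<lambda>(v, m). v), head = (\<lambda>(v, m). (v + gs ! m) mod N)\<rparr>"

text \<open>
  The predicate \<open>Digraph_Component.connected\<close> is weak connectedness (of the underlying undirected
  graph).  For finite \<open>G\<close>, the degree conditions give \<open>H\<close> exactly one arc less than it has
  vertices, so a connected such \<open>H\<close> is a tree, oriented towards \<open>v\<close>.
\<close>

definition spanning_arborescence ::
  "('a, 'b) pre_digraph \<Rightarrow> ('a, 'b) pre_digraph \<Rightarrow> 'a \<Rightarrow> bool" where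
  "spanning_arborescence H G v \<longleftrightarrow>
     spanning H G \<and> Digraph_Component.connected H \<and>
     out_degree H v = 0 \<and> (\<forall>u \<in> verts G - {v}. out_degree H u = 1)"

definition num_arborescences :: "('a, 'b) pre_digraph \<Rightarrow> 'a \<Rightarrow> nat" where
  "num_arborescences G v = card {H. spanning_arborescence H G v}"

definition num_spanning_trees :: "('a, 'b) pre_digraph \<Rightarrow> nat" where
  "num_spanning_trees G = (\<Sum>v \<in> verts G. num_arborescences G v)"

definition circ_gens :: "nat \<Rightarrow> nat \<Rightarrow> nat \<Rightarrow> (nat \<Rightarrow> nat) \<Rightarrow> nat list" where
  "circ_gens d p n \<gamma> = p # map (\<lambda>m. \<gamma> m * n + p) [1..<d]"

definition mu :: "nat \<Rightarrow> nat \<Rightarrow> (nat \<Rightarrow> nat) \<Rightarrow> nat \<Rightarrow> complex" where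
  "mu d \<beta> \<gamma> k =
     of_nat d - 1 - (\<Sum>m = 1..d - 1. exp (2 * of_real pi * \<i> * of_nat (\<gamma> m * k) / of_nat \<beta>))"

definition eta :: "nat \<Rightarrow> nat \<Rightarrow> (nat \<Rightarrow> nat) \<Rightarrow> nat \<Rightarrow> real" where
  "eta d \<beta> \<gamma> k =
     2 * (real d - 1) - 2 * (\<Sum>m = 1..d - 1. cos (2 * pi * real (\<gamma> m * k) / real \<beta>))"

text \<open>The sign function with value 1 at 0, unlike the library's \<open>sgn\<close>.\<close>

definition sgn1 :: "real \<Rightarrow> real" where
  "sgn1 x = (if x < 0 then -1 else 1)"

text \<open>
  The arctangent of \<open>y / x\<close>; for \<open>x = 0\<close> it is the limit of \<open>arctan (y / t)\<close> as \<open>t\<close> tends to 0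
  from the right, which is \<open>pi / 2\<close>, \<open>- pi / 2\<close> or 0 according to the sign of \<open>y\<close>.
\<close>

definition arctan_quot :: "real \<Rightarrow> real \<Rightarrow> real" where
  "arctan_quot y x = (if x = 0 then sgn y * (pi / 2) else arctan (y / x))"

definition theta :: "nat \<Rightarrow> nat \<Rightarrow> (nat \<Rightarrow> nat) \<Rightarrow> nat \<Rightarrow> real" where
  "theta d \<beta> \<gamma> k =
     arctan_quot (\<Sum>m = 1..d - 1. sin (2 * pi * real (\<gamma> m * k) / real \<beta>))
       (real d - eta d \<beta> \<gamma> k / 2)"

end

theory Submission
  imports Defs "Jordan_Normal_Form.Determinant" "HOL-Analysis.Complex_Transcendental"
begin

text \<open>
  Choosing one outgoing arc at every vertex other than \<open>v\<close> expands, row by row, the determinant of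
  the Laplacian reduced at \<open>v\<close> into determinants that are 1 if the chosen arcs form an arborescence
  and 0 otherwise.  The Laplacian of a circulant graph is diagonalised by the Fourier matrix, so
  that the sum over all roots is the product of the eigenvalues
  \<open>d - \<Sum>\<^sub>g exp (2 \<pi> i g j / N)\<close> over \<open>1 \<le> j < N\<close>.  For \<open>N = \<beta> n\<close>, write \<open>j = k + l \<beta>\<close>.  If \<open>p\<close> and \<open>n\<close>
  are coprime, then the product over \<open>l\<close> runs over all \<open>n\<close>-th roots of unity and collapses to
  \<open>d\<^sup>n - exp (2 \<pi> i p k / \<beta>) (d - \<mu>\<^sub>k)\<^sup>n\<close>, or to \<open>n d\<^bsup>n - 1\<^esup>\<close> for \<open>k = 0\<close>, where
  \<open>l = 0\<close> is left out; the factors for \<open>k\<close> and \<open>\<beta> - k\<close> are complex conjugates.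
  If some \<open>q > 1\<close> divides \<open>N\<close> and all generators, then the eigenvalue at \<open>N / q\<close> vanishes.
\<close>

section \<open>The matrix tree theorem\<close>

definition parent_rel :: "nat \<Rightarrow> nat \<Rightarrow> (nat \<Rightarrow> nat) \<Rightarrow> nat rel" where
  "parent_rel N v s = {(u, s u) | u. u < N \<and> u \<noteq> v}"

definition rooted_at :: "nat \<Rightarrow> nat \<Rightarrow> (nat \<Rightarrow> nat) \<Rightarrow> bool" where
  "rooted_at N v s \<longleftrightarrow> (\<forall>u<N. (u, v) \<in> (parent_rel N v s)\<^sup>*)"

text \<open>The unit row at \<open>v\<close> stands in for deleting row and column \<open>v\<close>:
  expanding along it gives the same determinant, and the indices stay \<open>0..<N\<close>.\<close>

definition parent_mat :: "nat \<Rightarrow> nat \<Rightarrow> (nat \<Rightarrow> nat) \<Rightarrow> 'a :: idom mat" where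
  "parent_mat N v s =
     Matrix.mat N N (\<lambda>(u, w). if u = v then of_bool (w = v) else of_bool (w = u) - of_bool (w = s u))"

lemma parent_mat_carrier [simp]: "parent_mat N v s \<in> carrier_mat N N"
  by (simp add: parent_mat_def)

text \<open>A vertex other than the root has exactly one successor, so every path from it to the
  root passes through that successor.\<close>

lemma parent_rel_step:
  assumes "u < N" "u \<noteq> v"
  shows "(u, v) \<in> (parent_rel N v s)\<^sup>* \<longleftrightarrow> (s u, v) \<in> (parent_rel N v s)\<^sup>*"
proof
  assume "(u, v) \<in> (parent_rel N v s)\<^sup>*"
  then show "(s u, v) \<in> (parent_rel N v s)\<^sup>*"
    using assms by (cases rule: converse_rtranclE) (auto simp: parent_rel_def)
next
  have "(u, s u) \<in> parent_rel N v s"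
    using assms by (auto simp: parent_rel_def)
  moreover assume "(s u, v) \<in> (parent_rel N v s)\<^sup>*"
  ultimately show "(u, v) \<in> (parent_rel N v s)\<^sup>*"
    by (rule converse_rtrancl_into_rtrancl)
qed

text \<open>Applies the Laplacian row of a single arc to a vector; \<open>a = b\<close> is allowed,
  so loops are covered.\<close>

lemma sum_delta_diff:
  assumes "finite A" "a \<in> A" "b \<in> A"
  shows "(\<Sum>j\<in>A. (of_bool (j = a) - of_bool (j = b)) * f j) = (f a - f b :: 'a :: comm_ring_1)"
proof -
  have "(\<Sum>j\<in>A. (of_bool (j = a) - of_bool (j = b)) * f j) =
      (\<Sum>j\<in>A. (if j = a then f j else 0) - (if j = b then f j else 0))"
    by (intro sum.cong) auto
  also have "\<dots> = f a - f b"
    using assms by (simp add: sum_subtractf)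
  finally show ?thesis .
qed

text \<open>The indicator of the vertices that do not reach the root lies in the kernel.\<close>

lemma det_parent_mat_not_rooted:
  assumes "v < N" and s: "\<And>u. u < N \<Longrightarrow> u \<noteq> v \<Longrightarrow> s u < N" and "\<not> rooted_at N v s"
  shows "det (parent_mat N v s :: 'a :: idom mat) = 0"
proof -
  let ?x = "\<lambda>w. of_bool ((w, v) \<notin> (parent_rel N v s)\<^sup>*) :: 'a"
  let ?A = "parent_mat N v s :: 'a mat"
  obtain u where u: "u < N" "(u, v) \<notin> (parent_rel N v s)\<^sup>*"
    using assms(3) by (auto simp: rooted_at_def)
  have "vec_index (Matrix.vec N ?x) u \<noteq> vec_index (0\<^sub>v N) u"
    using u by simp
  then have "Matrix.vec N ?x \<noteq> 0\<^sub>v N"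
    by metis
  moreover have "?A *\<^sub>v Matrix.vec N ?x = 0\<^sub>v N"
  proof (rule eq_vecI)
    fix i assume "i < dim_vec (0\<^sub>v N :: 'a Matrix.vec)"
    then have i: "i < N" by simp
    have "vec_index (?A *\<^sub>v Matrix.vec N ?x) i =
        (\<Sum>j = 0..<N. (if i = v then of_bool (j = v) else of_bool (j = i) - of_bool (j = s i)) * ?x j)"
      using i by (auto simp: parent_mat_def scalar_prod_def intro!: sum.cong)
    also have "\<dots> = 0"
    \<comment> \<open>Row \<open>v\<close> picks out the entry at \<open>v\<close>, which is 0
      because the root reaches itself. Any other row gives the difference of the entries at
      \<open>i\<close> and \<open>s i\<close>, which agree by
      \<open>parent_rel_step\<close>.\<close>
    proof (cases "i = v")
      case True
      then show ?thesis
        by (auto intro!: sum.neutral)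
    next
      case False
      then show ?thesis
        using i s[OF i False] parent_rel_step[of i N v s]
        by (simp only: if_False, subst sum_delta_diff) auto
    qed
    finally show "vec_index (?A *\<^sub>v Matrix.vec N ?x) i = vec_index (0\<^sub>v N) i"
      using i by simp
  qed (simp add: parent_mat_def)
  ultimately show ?thesis
    using det_0_iff_vec_prod_zero[OF parent_mat_carrier, of N v s] vec_carrier by blast
qed

text \<open>
  A permutation contributing to the Leibniz formula sends each vertex to itself or to its parent,
  and fixes the root; by injectivity it fixes a vertex as soon as it fixes the parent.
\<close>

lemma det_parent_mat_rooted:
  assumes "v < N" and rooted: "rooted_at N v s"
  shows "det (parent_mat N v s :: 'a :: idom mat) = 1"
proof -
  let ?A = "parent_mat N v s :: 'a mat"
  have fixes_all: "p = id"
    if p: "p permutes {0..<N}" and nz: "(\<Prod>i = 0..<N. ?A $$ (i, p i)) \<noteq> 0" for p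
  proof -
    have pN: "p i < N" if "i < N" for i
      using permutes_in_image[OF p, of i] that by simp
    have entry: "?A $$ (i, p i) \<noteq> 0" if "i < N" for i
      using nz that by (auto simp: prod_zero_iff)
    have "p u = u" if "(u, v) \<in> (parent_rel N v s)\<^sup>*" for u
      using that
    proof (induction rule: converse_rtrancl_induct)
      case base
      show ?case
        using entry[OF \<open>v < N\<close>] \<open>v < N\<close> pN[OF \<open>v < N\<close>]
        by (auto simp: parent_mat_def split: if_splits)
    next
      case (step u w)
      then have u: "u < N" "u \<noteq> v" "w = s u"
        by (auto simp: parent_rel_def)
      have "p u = u \<or> p u = p w"
        using entry[OF u(1)] u pN[OF u(1)] step.IH
        by (auto simp: parent_mat_def split: if_splits)
      then show ?case
        using permutes_inj[OF p] step.IH by (auto dest: injD)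
    qed
    then have "p u = u" if "u < N" for u
      using rooted that by (auto simp: rooted_at_def)
    moreover have "p u = u" if "\<not> u < N" for u
      using permutes_not_in[OF p] that by simp
    ultimately show ?thesis
      by (metis eq_id_iff)
  qed
  \<comment> \<open>A loop would turn the diagonal entry into \<open>1 - 1\<close>; but a vertex
    with a loop reaches only itself.\<close>
  have no_loop: "s u \<noteq> u" if u: "u < N" "u \<noteq> v" for u
  proof
    assume loop: "s u = u"
    have "w = u" if "(u, w) \<in> (parent_rel N v s)\<^sup>*" for w
      using that by (induction rule: rtrancl_induct) (auto simp: parent_rel_def loop)
    moreover have "(u, v) \<in> (parent_rel N v s)\<^sup>*"
      using rooted u by (auto simp: rooted_at_def)
    ultimately show False
      using u by auto
  qed
  have "det ?A = (\<Sum>p\<in>{p. p permutes {0..<N}}. signof p * (\<Prod>i = 0..<N. ?A $$ (i, p i)))"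
    by (rule det_def') simp
  also have "\<dots> = (\<Sum>p\<in>{id}. signof p * (\<Prod>i = 0..<N. ?A $$ (i, p i)))"
    by (rule sum.mono_neutral_right) (auto simp: finite_permutations permutes_id dest: fixes_all)
  also have "\<dots> = (\<Prod>i = 0..<N. ?A $$ (i, i))"
    by (simp add: sign_id)
  also have "\<dots> = 1"
    using no_loop by (intro prod.neutral) (fastforce simp: parent_mat_def)
  finally show ?thesis .
qed

lemma det_parent_mat:
  assumes "v < N" "\<And>u. u < N \<Longrightarrow> u \<noteq> v \<Longrightarrow> s u < N"
  shows "det (parent_mat N v s :: 'a :: idom mat) = of_bool (rooted_at N v s)"
  using det_parent_mat_not_rooted[of v N s, OF assms] det_parent_mat_rooted[of v N s, OF assms(1)]
  by (cases "rooted_at N v s") simp_all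

section \<open>Expansion of the reduced Laplacian over arc choices\<close>

text \<open>The value at the root \<open>v\<close> is a dummy.\<close>

definition arc_choices :: "nat \<Rightarrow> nat \<Rightarrow> nat \<Rightarrow> (nat \<Rightarrow> nat) set" where
  "arc_choices N d v = PiE {..<N} (\<lambda>u. if u = v then {0} else {..<d})"

lemma finite_arc_choices [simp]: "finite (arc_choices N d v)"
  unfolding arc_choices_def by (intro finite_PiE) auto

definition rooted_choices :: "nat \<Rightarrow> nat \<Rightarrow> (nat \<times> nat \<Rightarrow> nat) \<Rightarrow> nat \<Rightarrow> (nat \<Rightarrow> nat) set" where
  "rooted_choices N d h v = {f \<in> arc_choices N d v. rooted_at N v (\<lambda>u. h (u, f u))}"

text \<open>The root row is treated as in \<open>parent_mat\<close>. The other rows are written arc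
  by arc, ready for multilinear expansion; a loop contributes 0, as it does in out-degree minus
  adjacency.\<close>

definition reduced_laplacian :: "nat \<Rightarrow> nat \<Rightarrow> (nat \<times> nat \<Rightarrow> nat) \<Rightarrow> nat \<Rightarrow> 'a :: idom mat" where
  "reduced_laplacian N d h v =
     Matrix.mat N N (\<lambda>(u, w). if u = v then of_bool (w = v)
       else \<Sum>m<d. of_bool (w = u) - of_bool (w = h (u, m)))"

lemma reduced_laplacian_carrier [simp]: "reduced_laplacian N d h v \<in> carrier_mat N N"
  by (simp add: reduced_laplacian_def)

theorem det_reduced_laplacian:
  assumes v: "v < N" and h: "\<And>u m. u < N \<Longrightarrow> m < d \<Longrightarrow> h (u, m) < N"
  shows "det (reduced_laplacian N d h v :: 'a :: idom mat) = of_nat (card (rooted_choices N d h v))"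
proof -
  let ?B = "\<lambda>u. if u = v then {0} else {..<d}"
  let ?c = "\<lambda>u m w. (if u = v then of_bool (w = v) else of_bool (w = u) - of_bool (w = h (u, m))) :: 'a"
  let ?P = "{p. p permutes {0..<N}}"
  let ?L = "reduced_laplacian N d h v :: 'a mat"
  define h' where "h' u m = (if m < d then h (u, m) else 0)" for u m
  have "det ?L = (\<Sum>p\<in>?P. signof p * (\<Prod>i = 0..<N. ?L $$ (i, p i)))"
    by (rule det_def') simp
  \<comment> \<open>The one-element index set at the root makes row \<open>v\<close> a sum of one
    term, so that the distributive law \<open>prod_sum_PiE\<close> treats all rows alike.\<close>
  also have "\<dots> = (\<Sum>p\<in>?P. signof p * (\<Prod>i\<in>{..<N}. \<Sum>m\<in>?B i. ?c i m (p i)))"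
  proof (intro sum.cong refl arg_cong2[where f = "(*)"] prod.cong)
    fix p i assume "p \<in> ?P" "i \<in> {..<N}"
    then show "?L $$ (i, p i) = (\<Sum>m\<in>?B i. ?c i m (p i))"
      using permutes_in_image[of p "{0..<N}" i] by (auto simp: reduced_laplacian_def)
  qed auto
  also have "\<dots> = (\<Sum>p\<in>?P. signof p * (\<Sum>f\<in>arc_choices N d v. \<Prod>i\<in>{..<N}. ?c i (f i) (p i)))"
    unfolding arc_choices_def by (subst prod_sum_PiE) auto
  also have "\<dots> = (\<Sum>f\<in>arc_choices N d v. \<Sum>p\<in>?P. signof p * (\<Prod>i\<in>{..<N}. ?c i (f i) (p i)))"
    unfolding sum_distrib_left by (rule sum.swap)
  also have "\<dots> = (\<Sum>f\<in>arc_choices N d v. det (parent_mat N v (\<lambda>u. h (u, f u)) :: 'a mat))"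
  proof (intro sum.cong refl)
    fix f
    have "?c i (f i) (p i) = parent_mat N v (\<lambda>u. h (u, f u)) $$ (i, p i)"
      if "p permutes {0..<N}" "i < N" for p i
      using permutes_in_image[OF that(1), of i] that(2) by (simp add: parent_mat_def)
    then show "(\<Sum>p\<in>?P. signof p * (\<Prod>i\<in>{..<N}. ?c i (f i) (p i))) =
        det (parent_mat N v (\<lambda>u. h (u, f u)) :: 'a mat)"
      by (subst det_def'[OF parent_mat_carrier])
        (auto intro!: sum.cong prod.cong simp: atLeast0LessThan)
  qed
  also have "\<dots> = (\<Sum>f\<in>arc_choices N d v. of_bool (rooted_at N v (\<lambda>u. h (u, f u))))"
  proof (intro sum.cong refl)
    fix f assume f: "f \<in> arc_choices N d v"
    have "f u < d" if "u < N" "u \<noteq> v" for u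
      using f that by (auto simp: arc_choices_def PiE_iff split: if_splits)
    then show "det (parent_mat N v (\<lambda>u. h (u, f u)) :: 'a mat) =
        of_bool (rooted_at N v (\<lambda>u. h (u, f u)))"
      using v h by (intro det_parent_mat) auto
  qed
  also have "\<dots> = of_nat (card (rooted_choices N d h v))"
    unfolding rooted_choices_def by (subst sum_of_bool_eq) (simp_all add: Int_def)
  finally show ?thesis .
qed

section \<open>Arborescences as arc choices\<close>

definition arc_choice_graph :: "nat \<Rightarrow> (nat \<times> nat \<Rightarrow> nat) \<Rightarrow> nat \<Rightarrow> (nat \<Rightarrow> nat) \<Rightarrow> (nat, nat \<times> nat) pre_digraph" where
  "arc_choice_graph N h v f =
     \<lparr>verts = {..<N}, arcs = (\<lambda>u. (u, f u)) ` ({..<N} - {v}), tail = fst, head = h\<rparr>"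

text \<open>Weak connectedness already yields directed paths to the root: with at most one successor
  per vertex, reaching the root is preserved along an arc in both directions.\<close>

lemma connected_arc_choice_graph:
  assumes v: "v < N" and h: "\<And>u. u < N \<Longrightarrow> u \<noteq> v \<Longrightarrow> h (u, f u) < N"
  shows "Digraph_Component.connected (arc_choice_graph N h v f) \<longleftrightarrow> rooted_at N v (\<lambda>u. h (u, f u))"
proof -
  define R where "R = parent_rel N v (\<lambda>u. h (u, f u))"
  have ends: "arcs_ends (arc_choice_graph N h v f) = R"
    by (auto simp: arcs_ends_conv arc_choice_graph_def R_def parent_rel_def image_iff)
  have conn: "Digraph_Component.connected (arc_choice_graph N h v f) \<longleftrightarrow>
      (\<forall>a<N. \<forall>b<N. (a, b) \<in> rtrancl_on {..<N} (R\<^sup>s))"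
    using v unfolding connected_conv ends by (auto simp: arc_choice_graph_def)
  have R_closed: "b < N" if "(a, b) \<in> R" for a b
    using that h by (auto simp: R_def parent_rel_def)
  have sym: "sym (rtrancl_on {..<N} (R\<^sup>s))"
    by (rule rtrancl_on_sym) (auto simp: symcl_def sym_def)
  have "(a, v) \<in> R\<^sup>*" if "(a, v) \<in> rtrancl_on {..<N} (R\<^sup>s)" for a
    using that
  proof (induction rule: converse_rtrancl_on_induct)
    case (step x y)
    then consider "(x, y) \<in> R" | "(y, x) \<in> R"
      by (auto simp: symcl_def)
    then show ?case
    proof cases
      case 1
      then show ?thesis
        using step by auto
    next
      \<comment> \<open>The root has no successor, so \<open>y\<close> is not the root, and its path
        to the root continues through its only successor \<open>x\<close>.\<close>
      case 2
      then show ?thesis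
        using step.IH parent_rel_step[of y N v "\<lambda>u. h (u, f u)"]
        by (auto simp: R_def parent_rel_def)
    qed
  qed simp
  moreover have "(a, v) \<in> rtrancl_on {..<N} (R\<^sup>s)" if "(a, v) \<in> R\<^sup>*" "a < N" for a
  proof -
    have "(a, v) \<in> rtrancl_on {..<N} R"
      using that v R_closed by (intro rtrancl_consistent_rtrancl_on) auto
    then show ?thesis
      by (rule rtrancl_on_mono[rotated 2]) (auto simp: symcl_def)
  qed
  ultimately show ?thesis
    unfolding conn rooted_at_def R_def[symmetric] using v sym
    by (meson symE rtrancl_on_trans)
qed

text \<open>The degree conditions say that the arcs of \<open>H\<close> form the graph of a function
  on the vertices other than \<open>v\<close>. This function is the arc choice, and connectedness
  becomes \<open>rooted_at\<close>.\<close>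

lemma spanning_arborescence_iff:
  fixes N d :: nat and h :: "nat \<times> nat \<Rightarrow> nat"
  defines "G \<equiv> \<lparr>verts = {..<N}, arcs = {..<N} \<times> {..<d}, tail = fst, head = h\<rparr>"
  assumes v: "v < N" and h: "\<And>u m. u < N \<Longrightarrow> m < d \<Longrightarrow> h (u, m) < N"
  shows "spanning_arborescence H G v \<longleftrightarrow> H \<in> arc_choice_graph N h v ` rooted_choices N d h v"
proof
  assume H: "spanning_arborescence H G v"
  then have sub: "verts H = {..<N}" "arcs H \<subseteq> {..<N} \<times> {..<d}" "tail H = fst" "head H = h"
    by (auto simp: spanning_arborescence_def spanning_def subgraph_def compatible_def G_def)
  \<comment> \<open>\<open>card\<close> is 0 on infinite sets as well, so finiteness is what turns
    out-degree 0 into the absence of arcs.\<close>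
  have fin: "finite (out_arcs H u)" for u
    by (rule finite_subset[of _ "{..<N} \<times> {..<d}"]) (use sub in auto)
  have root: "out_arcs H v = {}"
    using H fin by (auto simp: spanning_arborescence_def out_degree_def)
  have "\<exists>m. out_arcs H u = {(u, m)}" if "u < N" "u \<noteq> v" for u
  proof -
    have "card (out_arcs H u) = 1"
      using H that by (auto simp: spanning_arborescence_def out_degree_def G_def)
    then obtain e where e: "out_arcs H u = {e}"
      by (rule card_1_singletonE)
    then have "fst e = u"
      using sub(3) by (metis in_out_arcs_conv insertI1)
    with e show ?thesis
      by (metis prod.collapse)
  qed
  then obtain m where m: "\<And>u. u < N \<Longrightarrow> u \<noteq> v \<Longrightarrow> out_arcs H u = {(u, m u)}"
    by metis
  \<comment> \<open>The dummy 0 at the root and the restriction to \<open>{..<N}\<close> give the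
    normal form that \<open>arc_choices\<close> prescribes.\<close>
  define f where "f = restrict (m(v := 0)) {..<N}"
  have arcs_H: "arcs H = (\<lambda>u. (u, f u)) ` ({..<N} - {v})"
  proof (intro equalityI subsetI)
    fix e assume e: "e \<in> arcs H"
    then have "e \<in> out_arcs H (fst e)" "fst e < N"
      using sub by auto
    moreover from this have "fst e \<noteq> v"
      using root by auto
    ultimately show "e \<in> (\<lambda>u. (u, f u)) ` ({..<N} - {v})"
      using m[of "fst e"] by (auto simp: f_def intro!: image_eqI[of _ _ "fst e"])
  next
    fix e assume "e \<in> (\<lambda>u. (u, f u)) ` ({..<N} - {v})"
    then obtain u where "u < N" "u \<noteq> v" "e = (u, m u)"
      by (auto simp: f_def)
    then have "e \<in> out_arcs H u"
      using m by auto
    then show "e \<in> arcs H"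
      by simp
  qed
  have H_eq: "H = arc_choice_graph N h v f"
    using sub arcs_H by (simp add: arc_choice_graph_def)
  have "f u < d" if "u < N" "u \<noteq> v" for u
    using arcs_H sub(2) that by auto
  then have "f \<in> arc_choices N d v" "\<And>u. u < N \<Longrightarrow> u \<noteq> v \<Longrightarrow> h (u, f u) < N"
    using v h by (auto simp: arc_choices_def f_def split: if_splits)
  moreover from this have "rooted_at N v (\<lambda>u. h (u, f u))"
    using H connected_arc_choice_graph[of v N h f] v
    by (auto simp: spanning_arborescence_def H_eq)
  ultimately show "H \<in> arc_choice_graph N h v ` rooted_choices N d h v"
    using H_eq by (auto simp: rooted_choices_def)
next
  assume "H \<in> arc_choice_graph N h v ` rooted_choices N d h v"
  then obtain f where H_eq: "H = arc_choice_graph N h v f" and f: "f \<in> arc_choices N d v"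
    and rooted: "rooted_at N v (\<lambda>u. h (u, f u))"
    by (auto simp: rooted_choices_def)
  have fd: "f u < d" if "u < N" "u \<noteq> v" for u
    using f that by (auto simp: arc_choices_def PiE_iff split: if_splits)
  have "wf_digraph G" "wf_digraph H"
    using h fd by (auto simp: wf_digraph_def G_def H_eq arc_choice_graph_def)
  then have "spanning H G"
    using fd by (auto simp: spanning_def subgraph_def compatible_def G_def H_eq arc_choice_graph_def)
  moreover have "out_arcs H u = (if u < N \<and> u \<noteq> v then {(u, f u)} else {})" for u
    by (auto simp: H_eq arc_choice_graph_def out_arcs_def)
  moreover have "Digraph_Component.connected H"
    using rooted connected_arc_choice_graph[of v N h f] v h fd by (auto simp: H_eq)
  ultimately show "spanning_arborescence H G v"
    by (auto simp: spanning_arborescence_def out_degree_def G_def)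
qed

text \<open>The arcs determine the choice away from the root; the dummy value and extensionality
  determine the rest.\<close>

lemma inj_on_arc_choice_graph: "inj_on (arc_choice_graph N h v) (arc_choices N d v)"
proof (rule inj_onI)
  fix f g assume fg: "f \<in> arc_choices N d v" "g \<in> arc_choices N d v"
    and "arc_choice_graph N h v f = arc_choice_graph N h v g"
  then have arcs_eq: "(\<lambda>u. (u, f u)) ` ({..<N} - {v}) = (\<lambda>u. (u, g u)) ` ({..<N} - {v})"
    by (simp add: arc_choice_graph_def)
  have "f u = g u" if "u < N" "u \<noteq> v" for u
  proof -
    have "(u, f u) \<in> (\<lambda>u. (u, g u)) ` ({..<N} - {v})"
      using that by (subst arcs_eq[symmetric]) auto
    then show ?thesis
      by auto
  qed
  moreover have "f v = g v" if "v < N"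
    using PiE_mem[OF fg(1)[unfolded arc_choices_def], of v] that
      PiE_mem[OF fg(2)[unfolded arc_choices_def], of v] by simp
  ultimately have "f u = g u" if "u < N" for u
    using that by (cases "u = v") simp_all
  then show "f = g"
    using fg unfolding arc_choices_def by (intro PiE_ext) auto
qed

text \<open>The matrix tree theorem for out-degree \<open>d\<close> at every vertex. The ring is
  left general so that the determinant can be taken over the complex numbers.\<close>

theorem num_arborescences_eq_det:
  assumes "v < N" "\<And>u m. u < N \<Longrightarrow> m < d \<Longrightarrow> h (u, m) < N"
  shows "of_nat (num_arborescences
       \<lparr>verts = {..<N}, arcs = {..<N} \<times> {..<d}, tail = fst, head = h\<rparr> v) =
     det (reduced_laplacian N d h v :: 'a :: idom mat)"
proof -
  have "{H. spanning_arborescence H \<lparr>verts = {..<N}, arcs = {..<N} \<times> {..<d}, tail = fst, head = h\<rparr> v} =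
      arc_choice_graph N h v ` rooted_choices N d h v"
    using spanning_arborescence_iff[of v N d h] assms by auto
  moreover have "inj_on (arc_choice_graph N h v) (rooted_choices N d h v)"
    by (rule inj_on_subset[OF inj_on_arc_choice_graph]) (auto simp: rooted_choices_def)
  ultimately show ?thesis
    using det_reduced_laplacian[of v N d h, where 'a = 'a] assms
    by (simp add: num_arborescences_def card_image)
qed

section \<open>Circulant graphs\<close>

text \<open>The Laplacian eigenvalue belonging to the character
  \<open>j \<mapsto> cis (2 * pi * j * k / N)\<close>, which is column \<open>k\<close> of the
  Fourier matrix below.\<close>

definition circ_eigenvalue :: "nat \<Rightarrow> nat list \<Rightarrow> nat \<Rightarrow> complex" where
  "circ_eigenvalue N gs k = (\<Sum>m<length gs. 1 - cis (2 * pi * real (gs ! m * k) / real N))"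

lemma cis_eq_1_iff_dvd:
  assumes "N > 0"
  shows "cis (2 * pi * real j / real N) = 1 \<longleftrightarrow> N dvd j"
  using complex_root_unity_eq_1[of N j] assms by (simp add: cis_conv_exp mult_ac)

lemma cis_power_mult:
  "cis (2 * pi * real j / real N) ^ k = cis (2 * pi * real (j * k) / real N)"
  unfolding Complex.DeMoivre by (simp add: mult_ac)

text \<open>Characters depend on residues only; this removes the \<open>mod\<close> from the heads
  of arcs.\<close>

lemma cis_mod:
  assumes "N > 0"
  shows "cis (2 * pi * real (j mod N * k) / real N) = cis (2 * pi * real (j * k) / real N)"
proof -
  have "real (j * k) = real (j mod N * k) + real N * real (j div N * k)"
    by (metis (no_types, opaque_lifting) add.commute distrib_right div_mult_mod_eq mult.commute
        mult.left_commute of_nat_add of_nat_mult)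
  then have "2 * pi * real (j * k) / real N =
      2 * pi * real (j mod N * k) / real N + 2 * pi * real (j div N * k)"
    using assms by (simp add: field_simps)
  then show ?thesis
    by (simp add: cis_mult[symmetric])
qed

lemma sum_roots_of_unity:
  assumes "N > 0"
  shows "(\<Sum>j<N. cis (2 * pi * real (j * k) / real N)) = of_nat N * of_bool (N dvd k)"
proof -
  let ?z = "cis (2 * pi * real k / real N)"
  have "(\<Sum>j<N. cis (2 * pi * real (j * k) / real N)) = (\<Sum>j<N. ?z ^ j)"
    unfolding cis_power_mult by (simp add: mult.commute)
  also have "\<dots> = of_nat N * of_bool (N dvd k)"
  proof (cases "N dvd k")
    case True
    then have "?z = 1"
      using assms by (simp only: cis_eq_1_iff_dvd)
    then show ?thesis
      using True by simp
  next
    case False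
    then have "?z \<noteq> 1"
      using assms by (simp only: cis_eq_1_iff_dvd) simp
    moreover have "?z ^ N = 1"
      using assms cis_eq_1_iff_dvd[of N "k * N"] unfolding cis_power_mult by simp
    ultimately show ?thesis
      using False by (simp add: geometric_sum)
  qed
  finally show ?thesis .
qed

section \<open>The Fourier matrix\<close>

definition fourier_mat :: "nat \<Rightarrow> complex mat" where
  "fourier_mat N = Matrix.mat N N (\<lambda>(j, k). cis (2 * pi * real (j * k) / real N))"

lemma fourier_mat_carrier [simp]: "fourier_mat N \<in> carrier_mat N N"
  by (simp add: fourier_mat_def)

text \<open>Orthogonality of characters: the product is the character of \<open>i - j\<close>,
  written as \<open>i + (N - j)\<close> to stay in the natural numbers.\<close>

lemma fourier_mat_cnj_sum:
  assumes "N > 0" "i < N" "j < N"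
  shows "(\<Sum>k<N. cis (2 * pi * real (i * k) / real N) * cis (- (2 * pi * real (j * k) / real N))) =
    of_nat N * of_bool (i = j)"
proof -
  have eq: "cis (2 * pi * real (i * k) / real N) * cis (- (2 * pi * real (j * k) / real N)) =
      cis (2 * pi * real (k * (i + (N - j))) / real N)" for k
  proof -
    have "2 * pi * real (k * (i + (N - j))) / real N =
        2 * pi * real (i * k) / real N + - (2 * pi * real (j * k) / real N) + 2 * pi * real k"
      using assms by (simp add: of_nat_diff field_simps)
    then show ?thesis
      by (simp only: cis_mult[symmetric]) simp
  qed
  have "N dvd i + (N - j) \<longleftrightarrow> i = j"
  proof
    assume "N dvd i + (N - j)"
    then obtain c where c: "i + (N - j) = N * c" ..
    have "N * c > N * 0" "N * c < N * 2"
      unfolding c[symmetric] using assms by linarith+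
    then have "c = 1"
      by simp
    with c show "i = j"
      using assms by simp
  qed (use assms in auto)
  then show ?thesis
    unfolding eq by (simp only: sum_roots_of_unity[OF assms(1)])
qed

lemma det_fourier_mat_nonzero:
  assumes "N > 0"
  shows "det (fourier_mat N) \<noteq> 0"
proof -
  let ?C = "Matrix.mat N N (\<lambda>(k, j). cis (- (2 * pi * real (j * k) / real N)))"
  have "fourier_mat N * ?C = of_nat N \<cdot>\<^sub>m 1\<^sub>m N"
    using fourier_mat_cnj_sum[OF assms]
    by (intro eq_matI) (auto simp: fourier_mat_def scalar_prod_def atLeast0LessThan)
  then have "det (fourier_mat N) * det ?C = det (of_nat N \<cdot>\<^sub>m 1\<^sub>m N)"
    by (metis det_mult fourier_mat_carrier mat_carrier)
  also have "\<dots> \<noteq> 0"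
    using assms by simp
  finally show ?thesis
    by auto
qed

text \<open>Cramer's rule: the solution \<open>?x\<close> of the system with right-hand side the
  unit vector has entry \<open>1 / N\<close> at 0.\<close>

lemma det_fourier_mat_replace_col:
  assumes "v < N"
  shows "det (replace_col (fourier_mat N) (unit_vec N v) 0) = det (fourier_mat N) / of_nat N"
proof -
  let ?x = "Matrix.vec N (\<lambda>k. cis (- (2 * pi * real (v * k) / real N)) / of_nat N)"
  have "fourier_mat N *\<^sub>v ?x = unit_vec N v"
  proof (rule eq_vecI)
    fix i assume "i < dim_vec (unit_vec N v :: complex Matrix.vec)"
    then have i: "i < N" by simp
    have "vec_index (fourier_mat N *\<^sub>v ?x) i = (\<Sum>k<N. cis (2 * pi * real (i * k) / real N) *
        cis (- (2 * pi * real (v * k) / real N))) / of_nat N"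
      using i by (simp add: fourier_mat_def scalar_prod_def atLeast0LessThan sum_divide_distrib)
    also have "\<dots> = of_bool (i = v)"
      using i assms by (subst fourier_mat_cnj_sum) auto
    finally show "vec_index (fourier_mat N *\<^sub>v ?x) i = vec_index (unit_vec N v) i"
      using i assms by (simp add: unit_vec_def)
  qed (simp add: fourier_mat_def)
  then show ?thesis
    using cramer_lemma_mat[of "fourier_mat N" N ?x 0] assms by simp
qed

text \<open>
  The Laplacian times the Fourier matrix \<open>F\<close> is \<open>F\<close> with columns scaled by the eigenvalues.  Since
  the eigenvalue at 0 vanishes, replacing row \<open>v\<close> of the Laplacian by a unit vector leaves the unit
  vector \<open>e\<^sub>v\<close> in column 0, and adding multiples of it corrects row \<open>v\<close>.
\<close>

theorem det_circulant_reduced_laplacian: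
  assumes v: "v < N"
  shows "det (reduced_laplacian N (length gs) (\<lambda>(u, m). (u + gs ! m) mod N) v) =
    (\<Prod>k = 1..<N. circ_eigenvalue N gs k) / of_nat N"
proof -
  have N: "N > 0" using v by simp
  let ?L = "reduced_laplacian N (length gs) (\<lambda>(u, m). (u + gs ! m) mod N) v :: complex mat"
  let ?F = "fourier_mat N"
  let ?w = "\<lambda>j k. cis (2 * pi * real (j * k) / real N)"
  let ?ev = "circ_eigenvalue N gs"
  define G where "G = replace_col ?F (unit_vec N v) 0"
  \<comment> \<open>Column 0 of \<open>G\<close> is already the required unit vector, so its scaling
    factor is 1 instead of the eigenvalue 0.\<close>
  define D where "D = mat_diag N (\<lambda>k. if k = 0 then 1 else ?ev k)"
  \<comment> \<open>In row \<open>v\<close>, column \<open>k\<close> of \<open>G * D\<close> holds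
    the eigenvalue times \<open>?w v k\<close> for \<open>k > 0\<close>. Adding this multiple of
    column 0 changes only that row and makes the entry \<open>?w v k\<close>.\<close>
  define T where "T = Matrix.mat N N (\<lambda>(i, k). of_bool (i = k) +
    (if i = 0 \<and> k \<noteq> 0 then (1 - ?ev k) * ?w v k else 0))"
  have carrier: "?L \<in> carrier_mat N N" "G \<in> carrier_mat N N" "D \<in> carrier_mat N N"
      "T \<in> carrier_mat N N" "?F \<in> carrier_mat N N" "G * D \<in> carrier_mat N N"
    by (auto simp: G_def D_def T_def replace_col_def fourier_mat_def reduced_laplacian_def mat_diag_def)
  have lambda0: "?ev 0 = 0"
    by (simp add: circ_eigenvalue_def)
  have LF: "(?L * ?F) $$ (i, k) = (if i = v then ?w v k else ?ev k * ?w i k)"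
    if ik: "i < N" "k < N" for i k
  proof (cases "i = v")
    case True
    then show ?thesis
      using ik v by (simp add: reduced_laplacian_def fourier_mat_def scalar_prod_def)
  next
    case False
    have "(?L * ?F) $$ (i, k) = (\<Sum>j = 0..<N. (\<Sum>m<length gs.
        (of_bool (j = i) - of_bool (j = (i + gs ! m) mod N)) * ?w j k))"
      using ik False by (simp add: reduced_laplacian_def fourier_mat_def scalar_prod_def sum_distrib_right)
    also have "\<dots> = (\<Sum>m<length gs. (\<Sum>j = 0..<N.
        (of_bool (j = i) - of_bool (j = (i + gs ! m) mod N)) * ?w j k))"
      by (rule sum.swap)
    also have "\<dots> = (\<Sum>m<length gs. ?w i k - ?w ((i + gs ! m) mod N) k)"
      using ik N by (subst sum_delta_diff) auto
    also have "\<dots> = (\<Sum>m<length gs. (1 - ?w (gs ! m) k) * ?w i k)"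
      unfolding cis_mod[OF N]
      by (intro sum.cong) (simp_all add: algebra_simps cis_mult add_divide_distrib)
    finally show ?thesis
      using False by (simp add: circ_eigenvalue_def sum_distrib_right)
  qed
  have GD: "(G * D) $$ (i, k) = (if k = 0 then of_bool (i = v) else ?ev k * ?w i k)"
    if "i < N" "k < N" for i k
    unfolding D_def mat_diag_mult_right[OF carrier(2)] using that carrier(2)
    by (simp add: G_def replace_col_def fourier_mat_def unit_vec_def mult.commute)
  have GDT: "(G * D * T) $$ (i, k) = (if i = v then ?w v k else ?ev k * ?w i k)"
    if ik: "i < N" "k < N" for i k
  proof -
    have "(G * D * T) $$ (i, k) = (\<Sum>j = 0..<N. (G * D) $$ (i, j) * T $$ (j, k))"
      using ik carrier by (subst index_mult_mat) (auto simp: scalar_prod_def)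
    also have "\<dots> = (\<Sum>j = 0..<N. (if j = k then (G * D) $$ (i, k) else 0) +
        (if j = 0 then if k = 0 then 0 else of_bool (i = v) * ((1 - ?ev k) * ?w v k) else 0))"
      using ik N by (intro sum.cong) (auto simp: T_def GD)
    also have "\<dots> = (if i = v then ?w v k else ?ev k * ?w i k)"
      using ik N by (simp add: sum.distrib GD lambda0 algebra_simps)
    finally show ?thesis .
  qed
  have "?L * ?F = G * D * T"
  proof (rule eq_matI)
    fix i j assume "i < dim_row (G * D * T)" "j < dim_col (G * D * T)"
    then have "i < N" "j < N"
      using carrier by auto
    then show "(?L * ?F) $$ (i, j) = (G * D * T) $$ (i, j)"
      by (simp only: LF GDT)
  qed (use carrier in \<open>auto simp: reduced_laplacian_def fourier_mat_def\<close>)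
  then have "det ?L * det ?F = det G * det D * det T"
    using carrier by (metis det_mult)
  moreover have "det T = 1"
  proof -
    have "det T = prod_list (diag_mat T)"
      by (rule det_upper_triangular[OF _ carrier(4)]) (auto simp: T_def)
    also have "\<dots> = 1"
      using carrier(4) by (auto simp: prod_list_diag_prod T_def intro!: prod.neutral)
    finally show ?thesis .
  qed
  moreover have "det D = (\<Prod>k = 1..<N. ?ev k)"
  proof -
    have "det D = prod_list (diag_mat D)"
      by (rule det_upper_triangular[OF _ carrier(3)]) (auto simp: D_def mat_diag_def)
    also have "\<dots> = (\<Prod>k = 0..<N. if k = 0 then 1 else ?ev k)"
      using carrier(3) by (auto simp: prod_list_diag_prod D_def mat_diag_def intro!: prod.cong)
    also have "\<dots> = (\<Prod>k = 1..<N. ?ev k)"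
      using N by (subst prod.atLeast_Suc_lessThan) auto
    finally show ?thesis .
  qed
  moreover have "det G = det ?F / of_nat N"
    unfolding G_def by (rule det_fourier_mat_replace_col[OF v])
  ultimately have "det ?F * det ?L = det ?F * ((\<Prod>k = 1..<N. ?ev k) / of_nat N)"
    by (simp add: mult_ac)
  then show ?thesis
    using det_fourier_mat_nonzero[OF N] mult_left_cancel by blast
qed

text \<open>The number of arborescences is the same for every root, so summing over the
  \<open>N\<close> roots cancels the division by \<open>N\<close>.\<close>

theorem num_spanning_trees_circulant:
  assumes "N > 0"
  shows "of_nat (num_spanning_trees (circulant_digraph N gs)) =
    (\<Prod>k = 1..<N. circ_eigenvalue N gs k)"
proof -
  have G: "circulant_digraph N gs = \<lparr>verts = {..<N}, arcs = {..<N} \<times> {..<length gs},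
      tail = fst, head = (\<lambda>(u, m). (u + gs ! m) mod N)\<rparr>"
    by (auto simp: circulant_digraph_def)
  have "of_nat (num_arborescences (circulant_digraph N gs) v) =
      (\<Prod>k = 1..<N. circ_eigenvalue N gs k) / of_nat N" if "v < N" for v
    unfolding G using that assms
    by (subst num_arborescences_eq_det) (auto simp: det_circulant_reduced_laplacian)
  then show ?thesis
    using assms by (simp add: num_spanning_trees_def circulant_digraph_def)
qed

text \<open>The character with index \<open>N / q\<close> equals 1 on all multiples of
  \<open>q\<close>, hence on all generators.\<close>

corollary num_spanning_trees_circulant_eq_0:
  assumes "N > 0" "q > 1" "q dvd N" and dvd: "\<And>g. g \<in> set gs \<Longrightarrow> q dvd g"
  shows "num_spanning_trees (circulant_digraph N gs) = 0"
proof -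
  obtain j where j: "N = q * j"
    using assms(3) by auto
  have "cis (2 * pi * real (gs ! m * j) / real N) = 1" if "m < length gs" for m
    using dvd[of "gs ! m"] that assms(1) by (simp only: cis_eq_1_iff_dvd) (simp add: j)
  then have "circ_eigenvalue N gs j = 0"
    by (simp only: circ_eigenvalue_def) simp
  moreover have "j \<in> {1..<N}"
    using assms(1,2) j by auto
  ultimately have "(\<Prod>k = 1..<N. circ_eigenvalue N gs k) = 0"
    by (intro prod_zero) auto
  then have "of_nat (num_spanning_trees (circulant_digraph N gs)) = (0 :: complex)"
    unfolding num_spanning_trees_circulant[OF assms(1)] .
  then show ?thesis
    by (simp only: of_nat_eq_0_iff)
qed

section \<open>Products over roots of unity\<close>

text \<open>Both sides are monic of degree \<open>n\<close> and vanish at the \<open>n\<close>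
  distinct powers of \<open>z\<close>.\<close>

lemma prod_linear_roots_of_unity:
  fixes z :: complex
  assumes n: "n > 0" and z: "z ^ n = 1" and inj: "inj_on (\<lambda>l. z ^ l) {..<n}"
  shows "(\<Prod>l<n. [:- (z ^ l), 1:]) = monom 1 n - 1"
proof (rule poly_eqI_degree_lead_coeff)
  let ?P = "\<Prod>l<n. [:- (z ^ l), 1:]"
  show "poly ?P x = poly (monom 1 n - 1) x" if "x \<in> (\<lambda>l. z ^ l) ` {..<n}" for x
  proof -
    obtain l where l: "l < n" "x = z ^ l"
      using \<open>x \<in> _\<close> by auto
    then have "x ^ n = 1"
      using z by (metis power_commutes power_mult power_one mult.commute)
    moreover have "poly ?P x = 0"
      using l by (auto simp: poly_prod)
    ultimately show ?thesis
      by (simp add: poly_monom)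
  qed
  show "n \<le> card ((\<lambda>l. z ^ l) ` {..<n})"
    using inj by (simp add: card_image)
  have "degree (monom (1 :: complex) n - 1) = n"
    using n by (subst diff_conv_add_uminus, subst degree_add_eq_left) (auto simp: degree_monom_eq)
  then show "degree (monom (1 :: complex) n - 1) \<le> n"
    by simp
  have "degree ?P = (\<Sum>l<n. degree [:- (z ^ l), 1:])"
    by (rule degree_prod_sum_eq) auto
  then have deg: "degree ?P = n"
    by simp
  then show "degree ?P \<le> n"
    by simp
  have "lead_coeff ?P = 1"
    by (simp add: lead_coeff_prod)
  then show "coeff ?P n = coeff (monom 1 n - 1) n"
    using n deg by simp
qed

text \<open>The homogeneous form: evaluate the preceding identity at \<open>a / b\<close> and
  multiply by the \<open>n\<close>-th power of \<open>b\<close>.\<close>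

lemma prod_diff_roots_of_unity:
  fixes z a b :: complex
  assumes "n > 0" "z ^ n = 1" "inj_on (\<lambda>l. z ^ l) {..<n}"
  shows "(\<Prod>l<n. a - b * z ^ l) = a ^ n - b ^ n"
proof (cases "b = 0")
  case False
  have "(\<Prod>l<n. a - b * z ^ l) = (\<Prod>l<n. b * (a / b - z ^ l))"
    using False by (intro prod.cong) (auto simp: field_simps)
  also have "\<dots> = b ^ n * poly (\<Prod>l<n. [:- (z ^ l), 1:]) (a / b)"
    by (simp add: prod.distrib poly_prod)
  also have "\<dots> = a ^ n - b ^ n"
    unfolding prod_linear_roots_of_unity[OF assms] using False
    by (simp add: poly_monom field_simps)
  finally show ?thesis .
qed (use assms in \<open>simp add: power_0_left\<close>)

text \<open>The factor \<open>X - 1\<close> is cancelled between polynomials, since it vanishes at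
  1; only then is 1 inserted, where the geometric sum equals \<open>n\<close>.\<close>

lemma prod_one_minus_roots_of_unity:
  fixes z :: complex
  assumes n: "n > 0" and "z ^ n = 1" "inj_on (\<lambda>l. z ^ l) {..<n}"
  shows "(\<Prod>l = 1..<n. 1 - z ^ l) = of_nat n"
proof -
  let ?X = "[:0, 1:] :: complex poly"
  have "[:-1, 1:] * (\<Prod>l = 1..<n. [:- (z ^ l), 1:]) = (\<Prod>l<n. [:- (z ^ l), 1:])"
    using n by (simp add: lessThan_atLeast0 prod.atLeast_Suc_lessThan)
  also have "\<dots> = ?X ^ n - 1"
    unfolding prod_linear_roots_of_unity[OF assms] by (simp add: monom_altdef)
  also have "\<dots> = (?X - 1) * (\<Sum>i<n. ?X ^ i)"
    by (rule power_diff_1_eq)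
  also have "?X - 1 = [:-1, 1:]"
    by (simp add: one_pCons)
  finally have "[:-1, 1:] * (\<Prod>l = 1..<n. [:- (z ^ l), 1:]) = [:-1, 1:] * (\<Sum>i<n. ?X ^ i)" .
  moreover have "[:-1, 1:] \<noteq> (0 :: complex poly)"
    by simp
  ultimately have "(\<Prod>l = 1..<n. [:- (z ^ l), 1:]) = (\<Sum>i<n. ?X ^ i)"
    using mult_left_cancel by blast
  then have "poly (\<Prod>l = 1..<n. [:- (z ^ l), 1:]) 1 = poly (\<Sum>i<n. ?X ^ i) 1"
    by simp
  then show ?thesis
    by (simp add: poly_prod poly_sum poly_power)
qed

text \<open>The arctangent gives the argument of \<open>z\<close> in the right half-plane and that
  of \<open>- z\<close> in the left one, whence the sign. On the imaginary axis the conventions at 0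
  give sign 1 and angle \<open>pi / 2\<close> or \<open>- pi / 2\<close>.\<close>

lemma complex_eq_arctan_quot:
  "z = of_real (sgn1 (Re z)) * rcis (cmod z) (arctan_quot (Im z) (Re z))"
proof -
  consider "Re z > 0" | "Re z < 0" | "Re z = 0" "Im z > 0" | "Re z = 0" "Im z < 0" | "z = 0"
    by (metis complex_eq_iff linorder_less_linear zero_complex.sel)
  then show ?thesis
  proof cases
    case 1
    then have "Arg z = arctan_quot (Im z) (Re z)"
      by (simp add: arg_conv_arctan arctan_quot_def)
    then show ?thesis
      using 1 rcis_cmod_Arg[of z] by (simp add: sgn1_def)
  next
    case 2
    then have "Arg (- z) = arctan_quot (Im z) (Re z)"
      by (simp add: arg_conv_arctan arctan_quot_def)
    then show ?thesis
      using 2 rcis_cmod_Arg[of "- z"] by (simp add: sgn1_def)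
  next
    case 3
    then show ?thesis
      by (simp add: sgn1_def arctan_quot_def rcis_def cmod_def complex_eq_iff)
  next
    case 4
    then show ?thesis
      by (simp add: sgn1_def arctan_quot_def rcis_def cmod_def complex_eq_iff)
  qed (simp add: rcis_def)
qed

text \<open>The indices \<open>k\<close> and \<open>\<beta> - k\<close> are paired; for even
  \<open>\<beta>\<close> the index \<open>\<beta> div 2\<close> is its own partner and stays
  alone.\<close>

lemma prod_reflect_cnj:
  fixes f :: "nat \<Rightarrow> complex"
  assumes "\<beta> \<ge> 1" and sym: "\<And>k. 1 \<le> k \<Longrightarrow> k < \<beta> \<Longrightarrow> f (\<beta> - k) = cnj (f k)"
  shows "(\<Prod>k = 1..<\<beta>. f k) =
    (if even \<beta> then f (\<beta> div 2) else 1) * (\<Prod>k = 1..nat \<lceil>real \<beta> / 2\<rceil> - 1. f k * cnj (f k))"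
proof -
  have ceil: "nat \<lceil>real \<beta> / 2\<rceil> - 1 = (\<beta> - 1) div 2"
  proof (cases "even \<beta>")
    case True
    then show ?thesis
      using assms(1) by (auto elim!: evenE)
  next
    case False
    then obtain b where b: "\<beta> = 2 * b + 1"
      by (rule oddE)
    have "\<lceil>real \<beta> / 2\<rceil> = int b + 1"
      by (rule ceiling_unique) (simp_all add: b)
    then show ?thesis
      by (simp add: b)
  qed
  define c where "c = (\<beta> - 1) div 2"
  have upper: "(\<Prod>k = \<beta> - c..<\<beta>. f k) = (\<Prod>k = 1..c. cnj (f k))"
  proof (rule prod.reindex_bij_witness[where i = "\<lambda>k. \<beta> - k" and j = "\<lambda>k. \<beta> - k"])
    fix k assume "k \<in> {\<beta> - c..<\<beta>}"
    then have "1 \<le> k" "k < \<beta>"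
      using assms(1) by (auto simp: c_def)
    then show "cnj (f (\<beta> - k)) = f k"
      using sym[of k] by simp
  qed (use assms(1) in \<open>auto simp: c_def\<close>)
  have middle: "(\<Prod>k = Suc c..<\<beta> - c. f k) = (if even \<beta> then f (\<beta> div 2) else 1)"
  proof (cases "even \<beta>")
    case True
    then have "{Suc c..<\<beta> - c} = {\<beta> div 2}"
      using assms(1) by (auto simp: c_def elim!: evenE)
    then show ?thesis
      using True by simp
  next
    case False
    then have "{Suc c..<\<beta> - c} = {}"
      by (auto simp: c_def elim!: oddE)
    then show ?thesis
      using False by simp
  qed
  have "(\<Prod>k = 1..<\<beta>. f k) = (\<Prod>k = 1..<Suc c. f k) * (\<Prod>k = Suc c..<\<beta>. f k)"
    using assms(1) by (subst prod.atLeastLessThan_concat) (auto simp: c_def)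
  also have "(\<Prod>k = Suc c..<\<beta>. f k) = (\<Prod>k = Suc c..<\<beta> - c. f k) * (\<Prod>k = \<beta> - c..<\<beta>. f k)"
    using assms(1) by (subst prod.atLeastLessThan_concat) (auto simp: c_def)
  finally have eq: "(\<Prod>k = 1..<\<beta>. f k) = (\<Prod>k = 1..<Suc c. f k) *
      ((\<Prod>k = Suc c..<\<beta> - c. f k) * (\<Prod>k = \<beta> - c..<\<beta>. f k))" .
  show ?thesis
    unfolding eq ceil c_def[symmetric] upper middle
    by (simp add: prod.distrib atLeastLessThanSuc_atLeastAtMost mult_ac)
qed

section \<open>Generators in arithmetic progression\<close>

text \<open>By coprimality \<open>n\<close> divides \<open>p * l\<close> only if it divides
  \<open>l\<close>, so the powers with exponents below \<open>n\<close> are distinct.\<close>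

lemma primitive_root_of_unity:
  assumes n: "n > 0" and coprime: "coprime n p"
  shows "cis (2 * pi * real p / real n) ^ n = 1"
    and "inj_on (\<lambda>l. cis (2 * pi * real p / real n) ^ l) {..<n}"
proof -
  let ?z = "cis (2 * pi * real p / real n)"
  have pow_eq_1: "?z ^ l = 1 \<longleftrightarrow> n dvd p * l" for l
    using n by (simp only: cis_power_mult cis_eq_1_iff_dvd)
  then show "?z ^ n = 1"
    by simp
  have "l = l'" if "l \<le> l'" "l' < n" "?z ^ l = ?z ^ l'" for l l'
  proof -
    have "?z ^ l' = ?z ^ l * ?z ^ (l' - l)"
      using that(1) by (simp flip: power_add)
    then have "?z ^ l * ?z ^ (l' - l) = ?z ^ l * 1"
      by (simp only: that(3) mult_1_right)
    then have "?z ^ (l' - l) = 1"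
      by simp
    then have "n dvd p * (l' - l)"
      by (simp only: pow_eq_1)
    then have "n dvd l' - l"
      by (simp only: coprime_dvd_mult_right_iff[OF coprime])
    then show ?thesis
      using that by (auto dest: dvd_imp_le)
  qed
  then show "inj_on (\<lambda>l. ?z ^ l) {..<n}"
    by (intro inj_onI) (metis lessThan_iff nat_le_linear)
qed

lemma cis_reflect:
  assumes "k < N"
  shows "cis (2 * pi * real (c * (N - k)) / real N) = cnj (cis (2 * pi * real (c * k) / real N))"
proof -
  have "2 * pi * real (c * (N - k)) / real N = - (2 * pi * real (c * k) / real N) + 2 * pi * real c"
    using assms by (simp add: of_nat_diff field_simps)
  then show ?thesis
    by (simp only: cis_mult[symmetric] cis_cnj) simp
qed

context
  fixes d \<beta> p n :: nat and \<gamma> :: "nat \<Rightarrow> nat"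
  assumes d: "d \<ge> 2" and \<beta>: "\<beta> \<ge> 1" and n: "n \<ge> 1" and coprime: "gcd p n = 1"
begin

text \<open>What remains of the sum of the generators' characters once the character value at
  \<open>p\<close> is factored out.\<close>

private definition char_sum :: "nat \<Rightarrow> complex" where
  "char_sum k = 1 + (\<Sum>m = 1..d - 1. cis (2 * pi * real (\<gamma> m * k) / real \<beta>))"

lemma char_sum_eq_mu: "char_sum k = of_nat d - mu d \<beta> \<gamma> k"
  by (simp add: char_sum_def mu_def cis_conv_exp mult_ac)

lemma Re_char_sum: "Re (char_sum k) = real d - eta d \<beta> \<gamma> k / 2"
  by (simp add: char_sum_def eta_def diff_divide_distrib)

lemma Im_char_sum: "Im (char_sum k) = (\<Sum>m = 1..d - 1. sin (2 * pi * real (\<gamma> m * k) / real \<beta>))"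
  by (simp add: char_sum_def)

text \<open>At index \<open>k + l * \<beta>\<close> the summand \<open>\<gamma> m * n\<close> of a
  generator contributes a \<open>\<beta>\<close>-th root of unity independent of \<open>l\<close>,
  so \<open>l\<close> enters only through \<open>p\<close>.\<close>

lemma circ_eigenvalue_circ_gens:
  "circ_eigenvalue (\<beta> * n) (circ_gens d p n \<gamma>) (k + l * \<beta>) =
    of_nat d - cis (2 * pi * real (p * k) / real (\<beta> * n)) * char_sum k * cis (2 * pi * real p / real n) ^ l"
proof -
  let ?c = "\<lambda>g. cis (2 * pi * real (g * (k + l * \<beta>)) / real (\<beta> * n))"
  have p_part: "?c p = cis (2 * pi * real (p * k) / real (\<beta> * n)) * cis (2 * pi * real p / real n) ^ l"
    unfolding Complex.DeMoivre cis_mult using \<beta> n by (intro arg_cong[where f = cis]) (simp add: field_simps)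
  have gamma_part: "?c (\<gamma> m * n + p) = ?c p * cis (2 * pi * real (\<gamma> m * k) / real \<beta>)" for m
  proof -
    have "2 * pi * real ((\<gamma> m * n + p) * (k + l * \<beta>)) / real (\<beta> * n) =
        2 * pi * real (p * (k + l * \<beta>)) / real (\<beta> * n) + 2 * pi * real (\<gamma> m * k) / real \<beta> +
        2 * pi * real (\<gamma> m * l)"
      using \<beta> n by (simp add: field_simps)
    then show ?thesis
      by (simp only: cis_mult[symmetric]) simp
  qed
  have eigenvalue: "circ_eigenvalue (\<beta> * n) gs j =
      of_nat (length gs) - (\<Sum>g\<leftarrow>gs. cis (2 * pi * real (g * j) / real (\<beta> * n)))" for gs j
    by (simp add: circ_eigenvalue_def sum_subtractf sum_list_sum_nth atLeast0LessThan)
  have length_gens: "length (circ_gens d p n \<gamma>) = d"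
    using d by (simp add: circ_gens_def)
  have sum_gens: "(\<Sum>g\<leftarrow>circ_gens d p n \<gamma>. ?c g) = ?c p * char_sum k"
  proof -
    have "(\<Sum>g\<leftarrow>circ_gens d p n \<gamma>. ?c g) = ?c p + (\<Sum>m\<leftarrow>[1..<d]. ?c (\<gamma> m * n + p))"
      by (simp add: circ_gens_def o_def)
    also have "\<dots> = ?c p + (\<Sum>m = 1..d - 1. ?c p * cis (2 * pi * real (\<gamma> m * k) / real \<beta>))"
    proof -
      have "{1..<d} = {1..d - 1}"
        using d by auto
      then show ?thesis
        unfolding gamma_part by (simp add: interv_sum_list_conv_sum_set_nat)
    qed
    finally show ?thesis
      by (simp add: char_sum_def distrib_left sum_distrib_left)
  qed
  show ?thesis
    unfolding eigenvalue length_gens sum_gens p_part by (simp only: mult_ac)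
qed

text \<open>Normalised so that, for \<open>0 < k < \<beta>\<close>, the eigenvalues with indices
  congruent to \<open>k\<close> modulo \<open>\<beta>\<close> have product
  \<open>d ^ n * (1 - block_term k)\<close>.\<close>

private definition block_term :: "nat \<Rightarrow> complex" where
  "block_term k = cis (2 * pi * real (p * k) / real \<beta>) * (char_sum k / of_nat d) ^ n"

lemma num_spanning_trees_eq_prod:
  "of_nat (num_spanning_trees (circulant_digraph (\<beta> * n) (circ_gens d p n \<gamma>))) =
    of_nat n * of_nat d ^ (\<beta> * n - 1) * (\<Prod>k = 1..<\<beta>. 1 - block_term k)"
proof -
  let ?ev = "circ_eigenvalue (\<beta> * n) (circ_gens d p n \<gamma>)"
  let ?z = "cis (2 * pi * real p / real n)"
  have "coprime n p"
    using coprime by (simp add: coprime_iff_gcd_eq_1 gcd.commute)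
  then have root_of_unity: "?z ^ n = 1" "inj_on (\<lambda>l. ?z ^ l) {..<n}"
    using primitive_root_of_unity[of n p] n by auto
  \<comment> \<open>Putting 1 at the missing index 0 fills the range up to \<open>n\<close> complete
    blocks of length \<open>\<beta>\<close>.\<close>
  let ?g = "\<lambda>j. if j = 0 then 1 else ?ev j"
  have "{..<n * \<beta>} = insert 0 {1..<\<beta> * n}"
    using \<beta> n by (auto simp: mult.commute)
  then have "(\<Prod>j = 1..<\<beta> * n. ?ev j) = (\<Prod>j<n * \<beta>. ?g j)"
    by simp
  also have "\<dots> = (\<Prod>l<n. prod ?g {l * \<beta>..<l * \<beta> + \<beta>})"
    by (rule prod.nat_group[symmetric])
  also have "\<dots> = (\<Prod>l<n. \<Prod>k<\<beta>. ?g (k + l * \<beta>))"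
  proof (rule prod.cong[OF refl])
    fix l
    show "prod ?g {l * \<beta>..<l * \<beta> + \<beta>} = (\<Prod>k<\<beta>. ?g (k + l * \<beta>))"
      using prod.shift_bounds_nat_ivl[of ?g 0 "l * \<beta>" \<beta>]
      by (simp only: lessThan_atLeast0 add_0 add.commute)
  qed
  also have "\<dots> = (\<Prod>k<\<beta>. \<Prod>l<n. ?g (k + l * \<beta>))"
    by (rule prod.swap)
  also have "{..<\<beta>} = insert 0 {1..<\<beta>}"
    using \<beta> by auto
  also have "(\<Prod>k\<in>insert 0 {1..<\<beta>}. \<Prod>l<n. ?g (k + l * \<beta>)) =
      (\<Prod>l<n. ?g (l * \<beta>)) * (\<Prod>k = 1..<\<beta>. \<Prod>l<n. ?g (k + l * \<beta>))"
    by (subst prod.insert) (simp_all cong: if_cong)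
  \<comment> \<open>For \<open>k = 0\<close> the character sum is \<open>d\<close>, and the factor
    at \<open>l = 0\<close> is the 1 supplied by \<open>?g\<close>.\<close>
  also have "(\<Prod>l<n. ?g (l * \<beta>)) = (\<Prod>l = 1..<n. of_nat d * (1 - ?z ^ l))"
  proof -
    have "{..<n} = insert 0 {1..<n}"
      using n by auto
    then have "(\<Prod>l<n. ?g (l * \<beta>)) = (\<Prod>l = 1..<n. ?g (l * \<beta>))"
      by simp
    also have "\<dots> = (\<Prod>l = 1..<n. of_nat d * (1 - ?z ^ l))"
    proof (intro prod.cong refl)
      fix l assume "l \<in> {1..<n}"
      then have "?g (l * \<beta>) = ?ev (0 + l * \<beta>)"
        using \<beta> by simp
      also have "\<dots> = of_nat d - char_sum 0 * ?z ^ l"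
        unfolding circ_eigenvalue_circ_gens by simp
      also have "char_sum 0 = of_nat d"
        using d by (simp add: char_sum_def)
      finally show "?g (l * \<beta>) = of_nat d * (1 - ?z ^ l)"
        by (simp only: right_diff_distrib mult_1_right)
    qed
    finally show ?thesis .
  qed
  also have "\<dots> = of_nat d ^ (n - 1) * of_nat n"
    using prod_one_minus_roots_of_unity[OF _ root_of_unity] n by (simp add: prod.distrib)
  also have "(\<Prod>k = 1..<\<beta>. \<Prod>l<n. ?g (k + l * \<beta>)) = (\<Prod>k = 1..<\<beta>. of_nat d ^ n * (1 - block_term k))"
  proof (intro prod.cong refl)
    fix k assume "k \<in> {1..<\<beta>}"
    then have "(\<Prod>l<n. ?g (k + l * \<beta>)) =
        (\<Prod>l<n. of_nat d - cis (2 * pi * real (p * k) / real (\<beta> * n)) * char_sum k * ?z ^ l)"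
      by (simp add: circ_eigenvalue_circ_gens)
    also have "\<dots> = of_nat d ^ n - (cis (2 * pi * real (p * k) / real (\<beta> * n)) * char_sum k) ^ n"
      using n root_of_unity by (intro prod_diff_roots_of_unity) auto
    also have "\<dots> = of_nat d ^ n - cis (2 * pi * real (p * k) / real \<beta>) * char_sum k ^ n"
    proof -
      have "real n * (2 * pi * real (p * k) / real (\<beta> * n)) = 2 * pi * real (p * k) / real \<beta>"
        using n by simp
      then show ?thesis
        by (simp only: power_mult_distrib Complex.DeMoivre)
    qed
    also have "\<dots> = of_nat d ^ n * (1 - block_term k)"
      using d by (simp add: block_term_def power_divide right_diff_distrib)
    finally show "(\<Prod>l<n. ?g (k + l * \<beta>)) = of_nat d ^ n * (1 - block_term k)" .
  qed
  also have "\<dots> = of_nat d ^ (n * (\<beta> - 1)) * (\<Prod>k = 1..<\<beta>. 1 - block_term k)"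
    by (simp add: prod.distrib power_mult)
  also have "of_nat d ^ (n - 1) * of_nat n * (of_nat d ^ (n * (\<beta> - 1)) * (\<Prod>k = 1..<\<beta>. 1 - block_term k)) =
      of_nat n * of_nat d ^ (\<beta> * n - 1) * (\<Prod>k = 1..<\<beta>. 1 - block_term k)"
  proof -
    have "\<beta> * n - 1 = n - 1 + n * (\<beta> - 1)"
      using \<beta> n by (cases \<beta>; cases n) (simp_all add: algebra_simps)
    then show ?thesis
      by (simp add: power_add mult_ac)
  qed
  finally show ?thesis
    using \<beta> n by (subst num_spanning_trees_circulant) auto
qed

lemma block_term_reflect: "k < \<beta> \<Longrightarrow> block_term (\<beta> - k) = cnj (block_term k)"
  by (simp only: block_term_def char_sum_def cis_reflect) simp

text \<open>At \<open>\<beta> div 2\<close> all character values are signs, as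
  \<open>cis (c * pi)\<close> is \<open>(- 1) ^ c\<close>.\<close>

lemma block_term_half:
  assumes "even \<beta>"
  shows "block_term (\<beta> div 2) = (- 1) ^ p * ((1 + (\<Sum>m = 1..d - 1. (- 1) ^ \<gamma> m)) / of_nat d) ^ n"
proof -
  have "2 * pi * real (c * (\<beta> div 2)) / real \<beta> = real c * pi" for c
    using assms \<beta> by (auto elim!: evenE)
  then have "cis (2 * pi * real (c * (\<beta> div 2)) / real \<beta>) = (- 1) ^ c" for c
    by (simp only: Complex.DeMoivre[symmetric]) simp
  then show ?thesis
    by (simp only: block_term_def char_sum_def)
qed

lemma cmod_block_term: "cmod (block_term k) = cmod (1 - mu d \<beta> \<gamma> k / of_nat d) ^ n"
proof -
  have "char_sum k / of_nat d = 1 - mu d \<beta> \<gamma> k / of_nat d"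
    using d by (simp add: char_sum_eq_mu field_simps)
  then show ?thesis
    by (simp add: block_term_def norm_mult norm_power)
qed

text \<open>\<open>complex_eq_arctan_quot\<close> puts \<open>char_sum k / d\<close> in polar form
  up to a sign; the \<open>n\<close>-th power multiplies the angle by \<open>n\<close>, and the
  factor from \<open>p\<close> shifts it.\<close>

lemma Re_block_term:
  "Re (block_term k) = sgn1 (real d - eta d \<beta> \<gamma> k / 2) ^ n * cmod (1 - mu d \<beta> \<gamma> k / of_nat d) ^ n *
    cos (2 * pi * real p * real k / real \<beta> + real n * theta d \<beta> \<gamma> k)"
proof -
  let ?s = "sgn1 (real d - eta d \<beta> \<gamma> k / 2)" and ?r = "cmod (1 - mu d \<beta> \<gamma> k / of_nat d)"
  have "char_sum k / of_nat d = of_real ?s * rcis (cmod (char_sum k)) (theta d \<beta> \<gamma> k) / of_nat d"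
    using complex_eq_arctan_quot[of "char_sum k"] by (simp add: theta_def Re_char_sum Im_char_sum)
  also have "cmod (char_sum k) = real d * ?r"
  proof -
    have "char_sum k = of_nat d * (1 - mu d \<beta> \<gamma> k / of_nat d)"
      using d by (simp add: char_sum_eq_mu right_diff_distrib)
    then show ?thesis
      by (simp only: norm_mult norm_of_nat)
  qed
  finally have "char_sum k / of_nat d = of_real (?s * ?r) * cis (theta d \<beta> \<gamma> k)"
    using d by (simp add: rcis_def)
  then have "block_term k = of_real ((?s * ?r) ^ n) *
      cis (2 * pi * real (p * k) / real \<beta> + real n * theta d \<beta> \<gamma> k)"
    by (simp only: block_term_def power_mult_distrib Complex.DeMoivre of_real_power of_real_mult
        cis_mult[symmetric] mult_ac)
  then show ?thesis
    by (simp add: power_mult_distrib mult.assoc)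
qed

text \<open>Keeping the \<open>n\<close>-th power of the sign covers both parities of
  \<open>n\<close> at once.\<close>

theorem num_spanning_trees_coprime:
  "real (num_spanning_trees (circulant_digraph (\<beta> * n) (circ_gens d p n \<gamma>))) =
     real n * real d ^ (\<beta> * n - 1)
     * (1 - of_bool (even \<beta>) * ((-1) ^ p / real d ^ n) * (1 + (\<Sum>m = 1..d - 1. (-1) ^ \<gamma> m)) ^ n)
     * (\<Prod>k = 1..nat \<lceil>real \<beta> / 2\<rceil> - 1.
          1 - 2 * sgn1 (real d - eta d \<beta> \<gamma> k / 2) ^ n * cmod (1 - mu d \<beta> \<gamma> k / of_nat d) ^ n
                * cos (2 * pi * real p * real k / real \<beta> + real n * theta d \<beta> \<gamma> k)
            + cmod (1 - mu d \<beta> \<gamma> k / of_nat d) ^ (2 * n))"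
    (is "_ = _ * _ * ?mid * (\<Prod>k = 1..?c. ?t k)")
proof -
  \<comment> \<open>This is the expansion of the squared modulus of \<open>1 - z\<close> as
    \<open>1 - 2 * Re z + cmod z ^ 2\<close>.\<close>
  have pair: "(1 - block_term k) * cnj (1 - block_term k) = of_real (?t k)" for k
  proof -
    have "(1 - block_term k) * cnj (1 - block_term k) = of_real (1 - 2 * Re (block_term k) + cmod (block_term k) ^ 2)"
      by (simp only: complex_mult_cnj cmod_power2) (simp add: power2_eq_square algebra_simps)
    then show ?thesis
      by (simp only: cmod_block_term Re_block_term power_mult[symmetric] mult_ac)
  qed
  have mid: "(if even \<beta> then 1 - block_term (\<beta> div 2) else 1) = of_real ?mid"
    by (simp add: block_term_half power_divide)
  have "(\<Prod>k = 1..<\<beta>. 1 - block_term k) = of_real (?mid * (\<Prod>k = 1..?c. ?t k))"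
    unfolding of_real_mult of_real_prod pair[symmetric] mid[symmetric]
    by (rule prod_reflect_cnj[OF \<beta>]) (simp add: block_term_reflect)
  then have "complex_of_real (real (num_spanning_trees (circulant_digraph (\<beta> * n) (circ_gens d p n \<gamma>)))) =
      of_real (real n * real d ^ (\<beta> * n - 1) * (?mid * (\<Prod>k = 1..?c. ?t k)))"
    using num_spanning_trees_eq_prod by simp
  then show ?thesis
    by (simp only: of_real_eq_iff mult.assoc)
qed

end

text \<open>The common divisor of the number of vertices and all generators is 2 in the first case
  and \<open>gcd p n\<close> in the second.\<close>

lemma num_spanning_trees_circ_gens_eq_0:
  assumes "\<beta> * n > 0"
    and "(even \<beta> \<and> even p \<and> (\<forall>m \<in> {1..d - 1}. even (\<gamma> m))) \<or> gcd p n \<noteq> 1"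
  shows "num_spanning_trees (circulant_digraph (\<beta> * n) (circ_gens d p n \<gamma>)) = 0"
  using assms(2)
proof
  assume "even \<beta> \<and> even p \<and> (\<forall>m \<in> {1..d - 1}. even (\<gamma> m))"
  then show ?thesis
    using assms(1) by (intro num_spanning_trees_circulant_eq_0[where q = 2]) (auto simp: circ_gens_def)
next
  assume "gcd p n \<noteq> 1"
  moreover have "gcd p n > 0"
    using assms(1) by simp
  ultimately have "gcd p n > 1"
    by linarith
  then show ?thesis
    using assms(1) by (intro num_spanning_trees_circulant_eq_0[where q = "gcd p n"])
      (auto simp: circ_gens_def)
qed

theorem theorem2p1:
  fixes d \<beta> p n :: nat and \<gamma> :: "nat \<Rightarrow> nat"
  assumes "d \<ge> 2" and "\<beta> \<ge> 1" and "p \<ge> 1" and "n \<ge> 1"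
    and "\<And>m. 1 \<le> m \<Longrightarrow> m \<le> d - 1 \<Longrightarrow> 1 \<le> \<gamma> m \<and> \<gamma> m \<le> \<beta>"
    and "\<And>l m. 1 \<le> l \<Longrightarrow> l \<le> m \<Longrightarrow> m \<le> d - 1 \<Longrightarrow> \<gamma> l \<le> \<gamma> m"
  shows
    "(even n \<and> gcd p n = 1 \<longrightarrow>
       real (num_spanning_trees (circulant_digraph (\<beta> * n) (circ_gens d p n \<gamma>))) =
         real n * real d ^ (\<beta> * n - 1)
         * (1 - of_bool (even \<beta>) * ((-1) ^ p / real d ^ n)
                  * (1 + (\<Sum>m = 1..d - 1. (-1) ^ \<gamma> m)) ^ n)
         * (\<Prod>k = 1..nat \<lceil>real \<beta> / 2\<rceil> - 1.
              1 - 2 * cmod (1 - mu d \<beta> \<gamma> k / of_nat d) ^ n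
                    * cos (2 * pi * real p * real k / real \<beta> + real n * theta d \<beta> \<gamma> k)
                + cmod (1 - mu d \<beta> \<gamma> k / of_nat d) ^ (2 * n)))
     \<and>
     (odd n \<and> gcd p n = 1 \<longrightarrow>
       real (num_spanning_trees (circulant_digraph (\<beta> * n) (circ_gens d p n \<gamma>))) =
         real n * real d ^ (\<beta> * n - 1)
         * (1 - of_bool (even \<beta>) * ((-1) ^ p / real d ^ n)
                  * (1 + (\<Sum>m = 1..d - 1. (-1) ^ \<gamma> m)) ^ n)
         * (\<Prod>k = 1..nat \<lceil>real \<beta> / 2\<rceil> - 1.
              1 - 2 * sgn1 (real d - eta d \<beta> \<gamma> k / 2)
                    * cmod (1 - mu d \<beta> \<gamma> k / of_nat d) ^ n
                    * cos (2 * pi * real p * real k / real \<beta> + real n * theta d \<beta> \<gamma> k)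
                + cmod (1 - mu d \<beta> \<gamma> k / of_nat d) ^ (2 * n)))
     \<and>
     ((gcd p n = 1 \<and> even \<beta> \<and> even p \<and> (\<forall>m \<in> {1..d - 1}. even (\<gamma> m))) \<or> gcd p n \<noteq> 1 \<longrightarrow>
       num_spanning_trees (circulant_digraph (\<beta> * n) (circ_gens d p n \<gamma>)) = 0)"
proof (intro conjI impI, goal_cases)
  case 1
  \<comment> \<open>This holds at \<open>x = 0\<close> too, because \<open>sgn1\<close> takes the
    value 1 there.\<close>
  then have "sgn1 x ^ n = 1" for x
    by (simp add: sgn1_def)
  with 1 show ?case
    using num_spanning_trees_coprime[OF assms(1,2,4), of p \<gamma>] by (simp only: mult_1_right)
next
  case 2
  then have "sgn1 x ^ n = sgn1 x" for x
    by (simp add: sgn1_def)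
  with 2 show ?case
    using num_spanning_trees_coprime[OF assms(1,2,4), of p \<gamma>] by (simp only:)
next
  case 3
  then show ?case
    using assms(2,4) by (intro num_spanning_trees_circ_gens_eq_0) auto
qed

end
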